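(* Let $B$ be a unital $C^*$-algebra, let $A\subset B$ be a unital norm-closed subalgebra and let $\omega$ be a pure state on $B$. Let $E_\omega=\{\Omega\in\mathcal{S}(B):\Omega|_A=\omega|_A\}$. Then the following statements are equivalent. (i) The restriction $\omega|_A$ admits a unique state extension to $B$, i.e. $E_\omega=\{\omega\}$. (ii) $E_\omega$ is an $(A,\varepsilon)$-pinnacle set for every $\varepsilon>0$. (iii) $E_\omega$ is an $(A,\varepsilon)$-pinnacle set for some $\varepsilon>0$. (iv) For each compact subset $K\subset\mathcal{S}(B)$ not containing $\omega$, there is $x\in A$ such that $$\Omega(x^*x)>1>\psi(x^*x)$$ for every $\psi\in K$ and $\Omega\in E_\omega$.
   Context: A unital subalgebra of $B$ is a complex subalgebra, not necessarily self-adjoint, containing the unit $I$ of $B$. A state on a unital subspace of $B$ is a unital contractive linear functional; pure states are the extreme points of the convex set of states. $\mathcal{S}(B)$ is the state space of $B$ with the weak-$*$ topology; compactness in $\mathcal{S}(B)$ refers to this topology. Let $M\subset B$ be a unital subspace, $\omega$ a state on $B$, $E_\omega$ the set of states on $B$ agreeing with $\omega$ on $M$, and $\varepsilon>0$. The set $E_\omega$ is an $(M,\varepsilon)$-pinnacle set if, given any compact subset $K\subset\mathcal{S}(B)\setminus\{\omega\}$, there is $x\in M$ with $\|x\|\le 1+\varepsilon$ such that $\Omega(x^*x)>1>\psi(x^*x)$ for every $\Omega\in E_\omega$ and $\psi\in K$. *)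

theory Defs
  imports "HOL-Analysis.Analysis" "HOL-Library.Complex_Order"
begin

text \<open>
  Unital \<open>C\<^sup>*\<close>-algebras over \<open>\<complex>\<close>. The superclass \<^class>\<open>real_normed_algebra_1\<close>
  demands \<open>norm 1 = 1\<close>, which excludes only the zero algebra; that algebra has no states.
\<close>

class unital_cstar_algebra = real_normed_algebra_1 + banach +
  fixes scaleC :: "complex \<Rightarrow> 'a \<Rightarrow> 'a" (infixr "*\<^sub>C" 75)
    and star :: "'a \<Rightarrow> 'a"
  assumes scaleC_add_right: "c *\<^sub>C (x + y) = c *\<^sub>C x + c *\<^sub>C y"
    and scaleC_add_left: "(c + d) *\<^sub>C x = c *\<^sub>C x + d *\<^sub>C x"
    and scaleC_scaleC: "c *\<^sub>C d *\<^sub>C x = (c * d) *\<^sub>C x"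
    and scaleR_scaleC: "r *\<^sub>R x = complex_of_real r *\<^sub>C x"
    and mult_scaleC_left: "(c *\<^sub>C x) * y = c *\<^sub>C (x * y)"
    and mult_scaleC_right: "x * (c *\<^sub>C y) = c *\<^sub>C (x * y)"
    and norm_scaleC: "norm (c *\<^sub>C x) = cmod c * norm x"
    and star_star: "star (star x) = x"
    and star_add: "star (x + y) = star x + star y"
    and star_scaleC: "star (c *\<^sub>C x) = cnj c *\<^sub>C star x"
    and star_mult: "star (x * y) = star y * star x"
    and norm_star_mult_self: "norm (star x * x) = (norm x)\<^sup>2"

instantiation complex :: unital_cstar_algebra
begin

definition scaleC_complex :: "complex \<Rightarrow> complex \<Rightarrow> complex"
  where "scaleC_complex c x = c * x"

definition star_complex :: "complex \<Rightarrow> complex"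
  where "star_complex = cnj"

instance
  by standard
    (simp_all add: scaleC_complex_def star_complex_def algebra_simps norm_mult
      scaleR_conv_of_real power2_eq_square)

end

definition unital_subalgebra :: "'a::unital_cstar_algebra set \<Rightarrow> bool"
  where "unital_subalgebra A \<longleftrightarrow>
    1 \<in> A \<and>
    (\<forall>x\<in>A. \<forall>y\<in>A. x + y \<in> A) \<and>
    (\<forall>c. \<forall>x\<in>A. c *\<^sub>C x \<in> A) \<and>
    (\<forall>x\<in>A. \<forall>y\<in>A. x * y \<in> A)"

text \<open>
  States live in the type of bounded real-linear maps, because that type carries the
  library's vector space structure and topologies; complex homogeneity is required
  separately.
\<close>

definition states :: "('a::unital_cstar_algebra \<Rightarrow>\<^sub>L complex) set"
  where "states = {\<phi>.
    (\<forall>c x. blinfun_apply \<phi> (c *\<^sub>C x) = c * blinfun_apply \<phi> x) \<and>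
    blinfun_apply \<phi> 1 = 1 \<and>
    (\<forall>x. cmod (blinfun_apply \<phi> x) \<le> norm x)}"

definition pure_state :: "('a::unital_cstar_algebra \<Rightarrow>\<^sub>L complex) \<Rightarrow> bool"
  where "pure_state \<omega> \<longleftrightarrow> \<omega> extreme_point_of states"

text \<open>
  For scalar-valued maps the strong operator topology is the topology of pointwise
  convergence, that is, the weak-\<open>*\<close> topology.
\<close>

definition state_space :: "('a::unital_cstar_algebra \<Rightarrow>\<^sub>L complex) topology"
  where "state_space = subtopology strong_operator_topology states"

definition state_extensions ::
    "'a::unital_cstar_algebra set \<Rightarrow> ('a \<Rightarrow>\<^sub>L complex) \<Rightarrow> ('a \<Rightarrow>\<^sub>L complex) set"
  where "state_extensions M \<omega> =
    {\<Omega> \<in> states. \<forall>x\<in>M. blinfun_apply \<Omega> x = blinfun_apply \<omega> x}"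

text \<open>
  The inequalities between values of states are in the order of \<open>\<complex>\<close> given by
  \<^theory>\<open>HOL-Library.Complex_Order\<close>: \<open>z < w\<close> means \<open>Re z < Re w\<close> and \<open>Im z = Im w\<close>,
  so they include that the values at \<open>x\<^sup>*x\<close> are real.
\<close>

definition pinnacle_set ::
    "'a::unital_cstar_algebra set \<Rightarrow> real \<Rightarrow> ('a \<Rightarrow>\<^sub>L complex) \<Rightarrow> bool"
  where "pinnacle_set M \<epsilon> \<omega> \<longleftrightarrow>
    (\<forall>K. compactin state_space K \<and> \<omega> \<notin> K \<longrightarrow>
      (\<exists>x\<in>M. norm x \<le> 1 + \<epsilon> \<and>
        (\<forall>\<Omega>\<in>state_extensions M \<omega>. \<forall>\<psi>\<in>K.
          blinfun_apply \<Omega> (star x * x) > 1 \<and> 1 > blinfun_apply \<psi> (star x * x))))"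

end

theory Submission
  imports Defs
begin

text \<open>
  The chain "all pinnacle, hence some pinnacle, hence separation" is immediate, and separation
  forces uniqueness: for a second extension \<open>\<Omega>\<close> the compact set \<open>{\<Omega>}\<close> would demand
  \<open>\<Omega>(x\<^sup>*x) > 1 > \<Omega>(x\<^sup>*x)\<close>. The content is that uniqueness yields pinnacle sets.

  Let \<open>K\<close> be a compact set of states not containing the pure state \<open>\<omega>\<close>. Since \<open>\<omega>\<close> is an extreme
  point of a weak-* compact convex set, \<open>K\<close> lies in a compact convex set \<open>C\<close> of states that still
  misses \<open>\<omega>\<close> (\<open>pure_state_avoids_convex_neighbourhood\<close>). If \<open>\<omega>\<close> is the only extension of its
  restriction to \<open>A\<close>, no member of \<open>C\<close> agrees with \<open>\<omega>\<close> on \<open>A\<close>; so the images of \<open>\<omega>\<close> and \<open>C\<close> in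
  the dual of \<open>A\<close> can be separated, by an element of \<open>A\<close>
  (\<open>subspace_separates_convex_compact\<close>). Adding a multiple of the unit gives \<open>a \<in> A\<close> and \<open>\<eta> > 0\<close>
  with \<open>Re \<omega>(a) = \<eta>\<close> and \<open>Re \<psi>(a) \<le> -\<eta>\<close> on \<open>K\<close>.

  Now \<open>x = 1 + t a\<close> works for all small \<open>t > 0\<close>: its norm is at most \<open>1 + t \<parallel>a\<parallel>\<close>, and as states are
  Hermitian, \<open>\<phi>(x\<^sup>*x) = 1 + 2 t Re \<phi>(a) + O(t\<^sup>2)\<close> uniformly over all states \<open>\<phi>\<close>, so the sign of
  \<open>Re \<phi>(a)\<close> decides on which side of \<open>1\<close> the value lies.
\<close>

section \<open>States are Hermitian\<close>

lemma star_one: "star (1::'a::unital_cstar_algebra) = 1"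
  by (metis mult.right_neutral mult_1 star_mult star_star)

lemma
  assumes "\<phi> \<in> states"
  shows state_scaleC: "blinfun_apply \<phi> (c *\<^sub>C x) = c * blinfun_apply \<phi> x"
    and state_one: "blinfun_apply \<phi> 1 = 1"
    and state_bound: "cmod (blinfun_apply \<phi> x) \<le> norm x"
  using assms by (auto simp: states_def)

text \<open>
  For real \<open>s\<close> the \<open>C\<^sup>*\<close>-identity gives \<open>\<parallel>h + i s\<parallel>\<^sup>2 \<le> \<parallel>h\<parallel>\<^sup>2 + s\<^sup>2\<close>. If \<open>\<phi>(h)\<close> had imaginary part
  \<open>\<beta> \<noteq> 0\<close>, contractivity would bound \<open>(\<beta> + s)\<^sup>2\<close> by the same number, which is absurd once \<open>\<beta> s\<close>
  is large, since the terms \<open>s\<^sup>2\<close> cancel.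
\<close>

lemma state_real_on_selfadjoint:
  assumes \<phi>: "\<phi> \<in> states" and h: "star h = h"
  shows "Im (blinfun_apply \<phi> h) = 0"
proof (rule ccontr)
  define \<beta> where "\<beta> = Im (blinfun_apply \<phi> h)"
  assume "Im (blinfun_apply \<phi> h) \<noteq> 0"
  then have \<beta>: "\<beta> \<noteq> 0" by (simp add: \<beta>_def)
  \<comment> \<open>Makes the cross term \<open>2 \<beta> s\<close> equal to \<open>2 \<parallel>h\<parallel>\<^sup>2\<close>, more than the available \<open>\<parallel>h\<parallel>\<^sup>2\<close>.\<close>
  define s where "s = (norm h)\<^sup>2 / \<beta>"
  define y where "y = h + (\<i> * of_real s) *\<^sub>C 1"
  have "star y = h + (- (\<i> * of_real s)) *\<^sub>C 1"
    by (simp add: y_def star_add star_scaleC star_one h)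
  moreover have "(h + (- c) *\<^sub>C 1) * (h + c *\<^sub>C 1) = h * h + (- (c * c)) *\<^sub>C 1" for c
  proof -
    have "(h + (- c) *\<^sub>C 1) * (h + c *\<^sub>C 1)
        = h * h + (c *\<^sub>C h + (- c) *\<^sub>C h) + (- (c * c)) *\<^sub>C 1"
      by (simp add: distrib_left distrib_right mult_scaleC_left mult_scaleC_right
          scaleC_scaleC scaleC_add_right add_ac)
    also have "c *\<^sub>C h + (- c) *\<^sub>C h = 0"
      using scaleR_scaleC[of 0 h] by (simp flip: scaleC_add_left)
    finally show ?thesis by simp
  qed
  ultimately have yy: "star y * y = h * h + (of_real (s\<^sup>2)) *\<^sub>C 1"
    by (simp add: y_def power2_eq_square algebra_simps)
  have "(norm y)\<^sup>2 \<le> norm (h * h) + norm ((complex_of_real (s\<^sup>2)) *\<^sub>C (1::'a))"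
    by (metis yy norm_star_mult_self norm_triangle_ineq)
  also have "\<dots> \<le> (norm h)\<^sup>2 + s\<^sup>2"
    using norm_mult_ineq[of h h] by (simp add: norm_scaleC power2_eq_square norm_mult)
  finally have "(norm y)\<^sup>2 \<le> (norm h)\<^sup>2 + s\<^sup>2" .
  moreover have "(cmod (blinfun_apply \<phi> y))\<^sup>2 \<le> (norm y)\<^sup>2"
    by (simp add: state_bound[OF \<phi>] power_mono)
  moreover have "blinfun_apply \<phi> y = blinfun_apply \<phi> h + \<i> * of_real s"
    by (simp add: y_def blinfun.add_right state_scaleC[OF \<phi>] state_one[OF \<phi>])
  ultimately have "(Re (blinfun_apply \<phi> h))\<^sup>2 + (\<beta> + s)\<^sup>2 \<le> (norm h)\<^sup>2 + s\<^sup>2"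
    by (simp add: cmod_power2 \<beta>_def)
  then have "(\<beta> + s)\<^sup>2 \<le> (norm h)\<^sup>2 + s\<^sup>2"
    using zero_le_power2[of "Re (blinfun_apply \<phi> h)"] by linarith
  then have "\<beta>\<^sup>2 + 2 * (\<beta> * s) \<le> (norm h)\<^sup>2"
    by (simp add: power2_sum)
  moreover have "\<beta> * s = (norm h)\<^sup>2"
    using \<beta> by (simp add: s_def)
  moreover have "\<beta>\<^sup>2 > 0" "(norm h)\<^sup>2 \<ge> 0"
    using \<beta> by auto
  ultimately show False by linarith
qed

lemma state_star:
  assumes \<phi>: "\<phi> \<in> states"
  shows "blinfun_apply \<phi> (star x) = cnj (blinfun_apply \<phi> x)"
proof -
  have "Im (blinfun_apply \<phi> (x + star x)) = 0"
    by (rule state_real_on_selfadjoint[OF \<phi>]) (simp add: star_add star_star add.commute)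
  moreover have "Im (blinfun_apply \<phi> (\<i> *\<^sub>C (x + (-1) *\<^sub>C star x))) = 0"
    by (rule state_real_on_selfadjoint[OF \<phi>])
      (simp add: star_add star_star star_scaleC scaleC_add_right scaleC_scaleC add.commute)
  ultimately show ?thesis
    by (simp add: complex_eq_iff blinfun.add_right state_scaleC[OF \<phi>])
qed

text \<open>
  The first-order expansion behind the theorem. The value is displayed as a real number because
  the order on \<open>\<complex>\<close> compares only numbers with equal imaginary parts; the second part makes the
  remainder uniform over all states.
\<close>

lemma state_perturbed_square:
  assumes \<phi>: "\<phi> \<in> states"
  shows "blinfun_apply \<phi> (star (1 + t *\<^sub>R a) * (1 + t *\<^sub>R a))
    = of_real (1 + 2 * t * Re (blinfun_apply \<phi> a) + t\<^sup>2 * Re (blinfun_apply \<phi> (star a * a)))"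
    and "\<bar>Re (blinfun_apply \<phi> (star a * a))\<bar> \<le> (norm a)\<^sup>2"
proof -
  have "Im (blinfun_apply \<phi> (star a * a)) = 0"
    by (rule state_real_on_selfadjoint[OF \<phi>]) (simp add: star_mult star_star)
  moreover have "star (1 + t *\<^sub>R a) = 1 + t *\<^sub>R star a"
    by (simp add: star_add star_one scaleR_scaleC star_scaleC)
  moreover have "(1 + t *\<^sub>R star a) * (1 + t *\<^sub>R a)
      = 1 + t *\<^sub>R a + t *\<^sub>R star a + (t * t) *\<^sub>R (star a * a)"
    by (simp add: algebra_simps)
  ultimately show "blinfun_apply \<phi> (star (1 + t *\<^sub>R a) * (1 + t *\<^sub>R a))
    = of_real (1 + 2 * t * Re (blinfun_apply \<phi> a) + t\<^sup>2 * Re (blinfun_apply \<phi> (star a * a)))"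
    by (simp add: complex_eq_iff blinfun.add_right blinfun.scaleR_right
        state_one[OF \<phi>] state_star[OF \<phi>] power2_eq_square)
  have "cmod (blinfun_apply \<phi> (star a * a)) \<le> (norm a)\<^sup>2"
    by (metis state_bound[OF \<phi>] norm_star_mult_self)
  then show "\<bar>Re (blinfun_apply \<phi> (star a * a))\<bar> \<le> (norm a)\<^sup>2"
    using abs_Re_le_cmod order_trans by blast
qed

section \<open>Compactness and convexity in the weak-* topology\<close>

text \<open>
  The next two lemmas say that the weak-* topology is a vector space topology; they are what
  turns a convex hull of compact pieces into a continuous image of a compact space.
\<close>

lemma continuous_map_weak_star_scaleR:
  assumes "continuous_map X euclideanreal f" "continuous_map X strong_operator_topology g"
  shows "continuous_map X strong_operator_topology (\<lambda>x. f x *\<^sub>R g x)"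
  using assms unfolding continuous_on_strong_operator_topo_iff_coordinatewise blinfun.scaleR_left
  by (simp add: continuous_map_atin tendsto_scaleR)

lemma continuous_map_weak_star_add:
  assumes "continuous_map X strong_operator_topology f" "continuous_map X strong_operator_topology g"
  shows "continuous_map X strong_operator_topology (\<lambda>x. f x + g x)"
  using assms
  by (simp add: continuous_on_strong_operator_topo_iff_coordinatewise blinfun.add_left
      continuous_map_add)

lemma continuous_map_weak_star_Re:
  "continuous_map strong_operator_topology euclideanreal (\<lambda>f. Re (blinfun_apply f x))"
proof -
  have "continuous_map strong_operator_topology euclidean (Re \<circ> (\<lambda>f. blinfun_apply f x))"
    by (rule continuous_map_compose[OF strong_operator_topology_continuous_evaluation])
      (simp add: continuous_on_Re)
  then show ?thesis by (simp add: o_def)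
qed

lemma convex_states: "convex states"
proof (rule convexI)
  fix \<phi> \<psi> :: "'a \<Rightarrow>\<^sub>L complex" and u v :: real
  assume \<phi>: "\<phi> \<in> states" and \<psi>: "\<psi> \<in> states" and uv: "0 \<le> u" "0 \<le> v" "u + v = 1"
  have "cmod (u *\<^sub>R blinfun_apply \<phi> x + v *\<^sub>R blinfun_apply \<psi> x) \<le> norm x" for x
    by (rule convexD[OF convex_cball[of 0 "norm x"], simplified, OF _ _ uv])
      (simp_all add: state_bound \<phi> \<psi>)
  moreover have "u *\<^sub>R blinfun_apply \<phi> (c *\<^sub>C x) + v *\<^sub>R blinfun_apply \<psi> (c *\<^sub>C x)
      = c * (u *\<^sub>R blinfun_apply \<phi> x + v *\<^sub>R blinfun_apply \<psi> x)" for c x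
    by (simp add: state_scaleC[OF \<phi>] state_scaleC[OF \<psi>] distrib_left)
  moreover have "u *\<^sub>R blinfun_apply \<phi> 1 + v *\<^sub>R blinfun_apply \<psi> 1 = 1"
    using uv by (simp add: state_one[OF \<phi>] state_one[OF \<psi>] flip: scaleR_add_left)
  ultimately show "u *\<^sub>R \<phi> + v *\<^sub>R \<psi> \<in> states"
    by (simp add: states_def blinfun.add_left blinfun.scaleR_left)
qed

text \<open>
  The Banach-Alaoglu argument: regarded as plain functions, the states form a closed subset of a
  product of discs, which is compact by Tychonoff's theorem.
\<close>

lemma compactin_states:
  "compactin strong_operator_topology (states :: ('a::unital_cstar_algebra \<Rightarrow>\<^sub>L complex) set)"
proof -
  let ?lin = "\<lambda>f::'a \<Rightarrow> complex. (\<forall>x y. f (x + y) = f x + f y) \<and> (\<forall>c x. f (c *\<^sub>C x) = c * f x)"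
  define T where "T = {f. ?lin f \<and> f 1 = 1 \<and> (\<forall>x. cmod (f x) \<le> norm x)}"
  have coord: "continuous_on UNIV (\<lambda>f::'a \<Rightarrow> complex. f x)" for x
    by simp
  have "compactin (product_topology (\<lambda>i. euclidean) UNIV) (\<Pi>\<^sub>E x\<in>UNIV. cball (0::complex) (norm (x::'a)))"
    by (subst compactin_PiE) auto
  then have box: "compact (\<Pi>\<^sub>E x\<in>UNIV. cball (0::complex) (norm (x::'a)))"
    by (simp add: euclidean_product_topology)
  have "closed {f::'a \<Rightarrow> complex. ?lin f \<and> f 1 = 1}"
    by (intro closed_Collect_conj closed_Collect_all closed_Collect_eq
        continuous_on_add continuous_on_mult continuous_on_const coord)
  from compact_Int_closed[OF box this] have "compact T"
    by (rule back_subst) (auto simp: T_def PiE_iff)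
  have bl: "bounded_linear f" if "f \<in> T" for f
    by (rule bounded_linear_intro[of f 1])
      (use that in \<open>auto simp: T_def scaleR_scaleC[where 'a='a] scaleR_conv_of_real\<close>)
  \<comment> \<open>Both topologies are those of pointwise convergence, so \<open>T\<close> can be carried over to the
    type of bounded linear maps.\<close>
  have "continuous_map (top_of_set T) strong_operator_topology Blinfun"
    unfolding continuous_on_strong_operator_topo_iff_coordinatewise
  proof
    fix x
    show "continuous_map (top_of_set T) euclidean (\<lambda>f. blinfun_apply (Blinfun f) x)"
      by (rule continuous_map_eq[of _ _ "\<lambda>f. f x"])
        (auto simp: bl bounded_linear_Blinfun_apply intro: continuous_on_subset[OF coord])
  qed
  then have "compactin strong_operator_topology (Blinfun ` T)"
    by (rule image_compactin[rotated]) (simp add: compactin_subtopology \<open>compact T\<close>)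
  moreover have "Blinfun ` T = states"
  proof
    show "Blinfun ` T \<subseteq> states"
      by (auto simp: states_def bl bounded_linear_Blinfun_apply) (auto simp: T_def)
    show "states \<subseteq> Blinfun ` T"
    proof
      fix \<phi> :: "'a \<Rightarrow>\<^sub>L complex" assume "\<phi> \<in> states"
      then have "blinfun_apply \<phi> \<in> T"
        by (auto simp: T_def states_def blinfun.add_right)
      then show "\<phi> \<in> Blinfun ` T"
        by (metis blinfun_apply_inverse imageI)
    qed
  qed
  ultimately show ?thesis by simp
qed

text \<open>
  The convex hull of two convex sets consists of the segments between them, because a convex
  combination of two such segment points regroups into one point of each set. This presents the
  hull as the image of a product with the unit interval.
\<close>

lemma convex_hull_Un_segments:
  fixes S T :: "'v::real_vector set"
  assumes S: "convex S" "S \<noteq> {}" and T: "convex T" "T \<noteq> {}"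
  shows "convex hull (S \<union> T) = (\<lambda>(u, s, t). (1 - u) *\<^sub>R s + u *\<^sub>R t) ` ({0..1} \<times> S \<times> T)"
    (is "_ = ?J")
proof (rule hull_unique)
  show "S \<union> T \<subseteq> ?J"
  proof
    fix x assume "x \<in> S \<union> T"
    moreover obtain s0 t0 where "s0 \<in> S" "t0 \<in> T" using S T by auto
    ultimately show "x \<in> ?J"
      by (auto intro: image_eqI[of _ _ "(0, x, t0)"] image_eqI[of _ _ "(1, s0, x)"])
  qed
  show "convex ?J"
  proof (rule convexI)
    \<comment> \<open>Normalises the weights of a nonnegative combination; if both weights vanish, any point of
      the set will do.\<close>
    have join: "\<exists>z\<in>C. a *\<^sub>R x + b *\<^sub>R y = (a + b) *\<^sub>R z"
      if "convex C" "x \<in> C" "y \<in> C" "0 \<le> a" "0 \<le> b" for C :: "'v set" and x y a b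
    proof (cases "a + b = 0")
      case True
      then have "a = 0" "b = 0" using that by auto
      then show ?thesis using that by auto
    next
      case False
      then have "(a / (a + b)) *\<^sub>R x + (b / (a + b)) *\<^sub>R y \<in> C"
        using that by (intro convexD) (auto simp flip: add_divide_distrib)
      then show ?thesis
        by (rule bexI[rotated]) (use False in \<open>simp add: scaleR_add_right\<close>)
    qed
    fix x y and p q :: real
    assume xy: "x \<in> ?J" "y \<in> ?J" and pq: "0 \<le> p" "0 \<le> q" "p + q = 1"
    obtain u s t where x: "x = (1 - u) *\<^sub>R s + u *\<^sub>R t" "s \<in> S" "t \<in> T" "0 \<le> u" "u \<le> 1"
      using xy(1) by auto
    obtain v s' t' where y: "y = (1 - v) *\<^sub>R s' + v *\<^sub>R t'" "s' \<in> S" "t' \<in> T" "0 \<le> v" "v \<le> 1"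
      using xy(2) by auto
    obtain s'' where s'': "s'' \<in> S"
      "(p * (1 - u)) *\<^sub>R s + (q * (1 - v)) *\<^sub>R s' = (p * (1 - u) + q * (1 - v)) *\<^sub>R s''"
      using join[OF S(1) x(2) y(2), of "p * (1 - u)" "q * (1 - v)"] x y pq by auto
    obtain t'' where t'': "t'' \<in> T" "(p * u) *\<^sub>R t + (q * v) *\<^sub>R t' = (p * u + q * v) *\<^sub>R t''"
      using join[OF T(1) x(3) y(3), of "p * u" "q * v"] x y pq by auto
    have eq: "1 - (p * u + q * v) = p * (1 - u) + q * (1 - v)"
      using pq by (simp add: algebra_simps)
    have "p *\<^sub>R x + q *\<^sub>R y = ((p * (1 - u)) *\<^sub>R s + (q * (1 - v)) *\<^sub>R s')
        + ((p * u) *\<^sub>R t + (q * v) *\<^sub>R t')"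
      by (simp add: x(1) y(1) scaleR_add_right add_ac)
    also have "\<dots> = (1 - (p * u + q * v)) *\<^sub>R s'' + (p * u + q * v) *\<^sub>R t''"
      by (simp only: s'' t'' eq)
    finally have *: "p *\<^sub>R x + q *\<^sub>R y = (1 - (p * u + q * v)) *\<^sub>R s'' + (p * u + q * v) *\<^sub>R t''" .
    have "p * (1 - u) + q * (1 - v) \<ge> 0" "p * u + q * v \<ge> 0"
      using x y pq by simp_all
    then have "p * u + q * v \<in> {0..1}"
      using eq by auto
    then show "p *\<^sub>R x + q *\<^sub>R y \<in> ?J"
      using * s''(1) t''(1) by (auto intro!: image_eqI[of _ _ "(p * u + q * v, s'', t'')"])
  qed
  show "?J \<subseteq> C" if "S \<union> T \<subseteq> C" "convex C" for C
    using that by (auto intro!: convexD)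
qed

lemma compactin_convex_hull_Un:
  assumes S: "convex S" "compactin strong_operator_topology S"
    and T: "convex T" "compactin strong_operator_topology T"
  shows "compactin strong_operator_topology (convex hull (S \<union> T))"
proof (cases "S = {} \<or> T = {}")
  case True
  then show ?thesis using S T by (auto simp: hull_same)
next
  case False
  let ?X = "prod_topology euclideanreal (prod_topology strong_operator_topology strong_operator_topology)"
  have "compactin ?X ({0..1} \<times> S \<times> T)"
    using S T by (simp add: compactin_Times)
  moreover have "continuous_map ?X strong_operator_topology (\<lambda>(u, s, t). (1 - u) *\<^sub>R s + u *\<^sub>R t)"
    unfolding case_prod_beta
    by (intro continuous_map_weak_star_add continuous_map_weak_star_scaleR continuous_map_diff
        continuous_map_canonical_const continuous_map_fst
        continuous_map_compose[OF continuous_map_snd continuous_map_fst, unfolded o_def]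
        continuous_map_compose[OF continuous_map_snd continuous_map_snd, unfolded o_def])
  ultimately have "compactin strong_operator_topology
      ((\<lambda>(u, s, t). (1 - u) *\<^sub>R s + u *\<^sub>R t) ` ({0..1} \<times> S \<times> T))"
    by (rule image_compactin)
  then show ?thesis
    using False S T by (simp add: convex_hull_Un_segments)
qed

lemma compactin_convex_hull_Union:
  assumes "finite \<F>" and "\<And>S. S \<in> \<F> \<Longrightarrow> convex S \<and> compactin strong_operator_topology S"
  shows "compactin strong_operator_topology (convex hull (\<Union>\<F>))"
  using assms
proof (induction \<F> rule: finite_induct)
  case (insert S \<F>)
  then have "compactin strong_operator_topology (convex hull (S \<union> convex hull (\<Union>\<F>)))"
    by (intro compactin_convex_hull_Un) auto
  then show ?case by (simp flip: hull_Un_right)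
qed simp

text \<open>
  The half-space slices \<open>{\<psi>. Re \<psi>(b) \<le> Re \<omega>(b) - 1}\<close> of the state space cover all states but
  \<open>\<omega>\<close>, so finitely many of them cover \<open>K\<close>. Their convex hull is compact, and it misses \<open>\<omega>\<close>: an
  extreme point of the state space lying in the hull would have to lie in one of the slices.
  This is Milman's converse to the Krein-Milman theorem in the form needed here.
\<close>

lemma pure_state_avoids_convex_neighbourhood:
  assumes pure: "pure_state \<omega>" and K: "compactin state_space K" "\<omega> \<notin> K"
  obtains C where "convex C" "compactin strong_operator_topology C" "K \<subseteq> C" "C \<subseteq> states" "\<omega> \<notin> C"
proof -
  define slice where "slice b = {\<psi> \<in> states. Re (blinfun_apply \<psi> b) \<le> Re (blinfun_apply \<omega> b) - 1}" for b
  have Kc: "compactin strong_operator_topology K" and Ks: "K \<subseteq> states"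
    using K by (auto simp: state_space_def compactin_subtopology)
  have \<omega>: "\<omega> \<in> states" using pure by (simp add: pure_state_def extreme_point_of_def)
  let ?U = "\<lambda>b. {\<psi>. Re (blinfun_apply \<psi> b) \<in> {..< Re (blinfun_apply \<omega> b) - 1}}"
  have op: "openin strong_operator_topology (?U b)" for b
    using openin_continuous_map_preimage[OF continuous_map_weak_star_Re[of b],
        of "{..< Re (blinfun_apply \<omega> b) - 1}"]
    by (simp add: strong_operator_topology_topspace)
  have cover: "K \<subseteq> \<Union>(range ?U)"
  proof
    fix \<psi> assume "\<psi> \<in> K"
    then have \<psi>: "\<psi> \<in> states" "\<psi> \<noteq> \<omega>" using Ks K by auto
    then obtain b where b: "blinfun_apply \<omega> b - blinfun_apply \<psi> b \<noteq> 0"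
      by (metis blinfun_eqI right_minus_eq)
    \<comment> \<open>Dividing by \<open>d\<close> turns the difference into the real number 2, which exceeds the gap 1
      required by the open half-spaces.\<close>
    define d where "d = blinfun_apply \<omega> b - blinfun_apply \<psi> b"
    have "d \<noteq> 0" using b by (simp add: d_def)
    have "blinfun_apply \<omega> ((2 / d) *\<^sub>C b) - blinfun_apply \<psi> ((2 / d) *\<^sub>C b) = (2 / d) * d"
      by (simp only: state_scaleC[OF \<omega>] state_scaleC[OF \<psi>(1)] d_def right_diff_distrib)
    also have "\<dots> = 2" using \<open>d \<noteq> 0\<close> by simp
    finally have "Re (blinfun_apply \<omega> ((2 / d) *\<^sub>C b)) - Re (blinfun_apply \<psi> ((2 / d) *\<^sub>C b)) = 2"
      by (metis minus_complex.simps(1) complex_Re_numeral)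
    then show "\<psi> \<in> \<Union>(range ?U)" by (intro UN_I[of "(2 / d) *\<^sub>C b"]) auto
  qed
  obtain \<F> where \<F>: "finite \<F>" "\<F> \<subseteq> range ?U" "K \<subseteq> \<Union>\<F>"
    using compactinD[OF Kc, of "range ?U"] op cover by auto
  obtain F where "finite F" "\<F> = ?U ` F"
    using finite_subset_image[OF \<F>(1,2)] by blast
  then have F: "finite F" "K \<subseteq> (\<Union>b\<in>F. ?U b)"
    using \<F>(3) by auto
  have slice: "convex (slice b) \<and> compactin strong_operator_topology (slice b)" for b
  proof
    have "convex {\<psi>. Re (blinfun_apply \<psi> b) \<le> Re (blinfun_apply \<omega> b) - 1}"
      by (rule convexI) (simp add: blinfun.add_left blinfun.scaleR_left convex_bound_le)
    from convex_Int[OF convex_states this]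
    show "convex (slice b)" by (simp add: slice_def Collect_conj_eq)
    have "closedin strong_operator_topology
        {\<psi>. Re (blinfun_apply \<psi> b) \<in> {.. Re (blinfun_apply \<omega> b) - 1}}"
      using closedin_continuous_map_preimage[OF continuous_map_weak_star_Re[of b],
          of "{.. Re (blinfun_apply \<omega> b) - 1}"]
      by (simp add: strong_operator_topology_topspace)
    from compact_Int_closedin[OF compactin_states this]
    show "compactin strong_operator_topology (slice b)"
      by (simp add: slice_def Collect_conj_eq)
  qed
  define C where "C = convex hull (\<Union>(slice ` F))"
  show thesis
  proof
    show "convex C" by (simp add: C_def)
    show "compactin strong_operator_topology C"
      unfolding C_def by (rule compactin_convex_hull_Union) (use F slice in auto)
    show "C \<subseteq> states"
      unfolding C_def by (rule hull_minimal) (auto simp: slice_def convex_states)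
    have "?U b \<inter> states \<subseteq> slice b" for b by (auto simp: slice_def)
    then have "K \<subseteq> \<Union>(slice ` F)" using F(2) Ks by blast
    then show "K \<subseteq> C" unfolding C_def by (meson hull_subset order_trans)
    show "\<omega> \<notin> C"
    proof
      assume "\<omega> \<in> C"
      then have "\<omega> extreme_point_of C"
        using pure \<open>C \<subseteq> states\<close> by (auto simp: pure_state_def extreme_point_of_def)
      then have "\<omega> \<in> \<Union>(slice ` F)"
        unfolding C_def by (rule extreme_point_of_convex_hull)
      then show False by (auto simp: slice_def)
    qed
  qed
qed

section \<open>Separation by an element of a subspace\<close>

text \<open>
  A first-order optimality condition: \<open>2 s\<close> is the derivative at \<open>0\<close> of a quadratic function that
  is minimal there on the unit interval.
\<close>

lemma nonneg_of_nonneg_quadratic: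
  fixes s e :: real
  assumes "e \<ge> 0" and nn: "\<And>u. 0 < u \<Longrightarrow> u \<le> 1 \<Longrightarrow> 0 \<le> 2 * u * s + u\<^sup>2 * e"
  shows "s \<ge> 0"
proof (rule ccontr)
  assume "\<not> s \<ge> 0"
  define u where "u = min 1 (- s / (e + 1))"
  have "u \<le> - s / (e + 1)"
    by (simp add: u_def)
  then have "u * (e + 1) \<le> - s"
    using \<open>e \<ge> 0\<close> pos_le_divide_eq[of "e + 1" u "- s"] by simp
  moreover have "0 < u" "u \<le> 1"
    using \<open>\<not> s \<ge> 0\<close> \<open>e \<ge> 0\<close> by (auto simp: u_def divide_neg_pos)
  ultimately have u: "0 < u" "u \<le> 1" "u * (e + 1) \<le> - s"
    by auto
  then have "2 * s + u * e < 0"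
    using \<open>\<not> s \<ge> 0\<close> by (simp add: distrib_left)
  then have "u * (2 * s + u * e) < 0"
    using u by (simp add: mult_pos_neg)
  then show False
    using nn[OF u(1,2)] by (simp add: algebra_simps power2_eq_square)
qed

text \<open>
  A separation theorem that needs only a minimisation. By compactness, finitely many elements
  \<open>b \<in> F\<close> of \<open>A\<close> already tell \<open>\<omega>\<close> from every member of \<open>C\<close>. Let \<open>\<phi> \<in> C\<close> minimise the squared
  Euclidean distance \<open>\<Sum>b\<in>F. \<bar>\<psi>(b) - \<omega>(b)\<bar>\<^sup>2\<close>. As for a nearest point in Euclidean space, the
  hyperplane through \<open>\<phi>\<close> orthogonal to \<open>\<phi> - \<omega>\<close> separates; its normal vector has coordinates
  \<open>d b = \<phi>(b) - \<omega>(b)\<close>, so the separating functional is evaluation at a combination of the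
  elements of \<open>F\<close>, which lies in \<open>A\<close>.
\<close>

lemma subspace_separates_convex_compact:
  fixes A :: "'a::unital_cstar_algebra set"
  assumes one: "1 \<in> A" and add: "\<And>x y. x \<in> A \<Longrightarrow> y \<in> A \<Longrightarrow> x + y \<in> A"
    and scale: "\<And>c x. x \<in> A \<Longrightarrow> c *\<^sub>C x \<in> A"
    and C: "convex C" "compactin strong_operator_topology C" "C \<subseteq> states"
    and \<omega>: "\<omega> \<in> states" and disj: "C \<inter> state_extensions A \<omega> = {}"
  obtains a \<eta> where "a \<in> A" "\<eta> > 0"
    "\<And>\<psi>. \<psi> \<in> C \<Longrightarrow> Re (blinfun_apply \<psi> a) + \<eta> \<le> Re (blinfun_apply \<omega> a)"
proof (cases "C = {}")
  case True
  then show ?thesis using that[of 1 1] one by auto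
next
  case False
  let ?U = "\<lambda>a. {\<psi>. blinfun_apply \<psi> a \<in> - {blinfun_apply \<omega> a}}"
  have "openin strong_operator_topology (?U a)" for a
    using openin_continuous_map_preimage[OF strong_operator_topology_continuous_evaluation[of a],
        of "- {blinfun_apply \<omega> a}"]
    by (simp add: strong_operator_topology_topspace open_Compl)
  moreover have "C \<subseteq> \<Union>(?U ` A)"
    using C disj by (auto simp: state_extensions_def)
  ultimately obtain \<F> where \<F>: "finite \<F>" "\<F> \<subseteq> ?U ` A" "C \<subseteq> \<Union>\<F>"
    using compactinD[OF C(2), of "?U ` A"] by blast
  obtain F where "finite F" "F \<subseteq> A" "\<F> = ?U ` F"
    using finite_subset_image[OF \<F>(1,2)] by blast
  then have F: "finite F" "F \<subseteq> A" "C \<subseteq> (\<Union>a\<in>F. ?U a)"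
    using \<F>(3) by auto
  define g where "g \<psi> = (\<Sum>a\<in>F. (cmod (blinfun_apply \<psi> a - blinfun_apply \<omega> a))\<^sup>2)" for \<psi>
  have "continuous_map strong_operator_topology euclideanreal g"
    unfolding g_def
    by (intro continuous_map_sum continuous_map_real_pow continuous_map_norm continuous_map_diff
        continuous_map_canonical_const strong_operator_topology_continuous_evaluation F)
  then have "compact (g ` C)"
    using image_compactin[OF C(2)] by fastforce
  then obtain \<phi> where \<phi>: "\<phi> \<in> C" and min: "\<And>\<psi>. \<psi> \<in> C \<Longrightarrow> g \<phi> \<le> g \<psi>"
    using compact_attains_inf[of "g ` C"] False by auto
  define d where "d a = blinfun_apply \<phi> a - blinfun_apply \<omega> a" for a
  have pos: "g \<phi> > 0"
  proof -
    obtain a where "a \<in> F" "blinfun_apply \<phi> a \<noteq> blinfun_apply \<omega> a"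
      using \<phi> F(3) by auto
    then show ?thesis
      unfolding g_def by (intro sum_pos2[OF F(1)]) auto
  qed
  define a where "a = (\<Sum>b\<in>F. (- cnj (d b)) *\<^sub>C b)"
  have "a \<in> A"
    unfolding a_def using F(1,2)
  proof (induction F rule: finite_induct)
    case empty
    then show ?case using scale[OF one, of 0] scaleR_scaleC[of 0 "1::'a"] by simp
  qed (simp add: add scale)
  have val: "Re (blinfun_apply \<psi> a) = - (\<Sum>b\<in>F. d b \<bullet> blinfun_apply \<psi> b)"
    if "\<psi> \<in> states" for \<psi>
    by (simp add: a_def blinfun.sum_right state_scaleC[OF that] inner_complex_def
        sum_negf[symmetric])
  have "Re (blinfun_apply \<psi> a) + g \<phi> \<le> Re (blinfun_apply \<omega> a)" if \<psi>: "\<psi> \<in> C" for \<psi>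
  proof -
    define e where "e b = blinfun_apply \<psi> b - blinfun_apply \<phi> b" for b
    have "0 \<le> (\<Sum>b\<in>F. d b \<bullet> e b)"
    proof (rule nonneg_of_nonneg_quadratic)
      show "0 \<le> (\<Sum>b\<in>F. (cmod (e b))\<^sup>2)" by (simp add: sum_nonneg)
      fix u :: real assume u: "0 < u" "u \<le> 1"
      have "(1 - u) *\<^sub>R \<phi> + u *\<^sub>R \<psi> \<in> C"
        using u \<phi> \<psi> C(1) by (intro convexD) auto
      from min[OF this] have "g \<phi> \<le> g ((1 - u) *\<^sub>R \<phi> + u *\<^sub>R \<psi>)" .
      also have "\<dots> = (\<Sum>b\<in>F. (norm (d b + u *\<^sub>R e b))\<^sup>2)"
        by (auto simp: g_def d_def e_def blinfun.add_left blinfun.diff_left blinfun.scaleR_left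
            algebra_simps intro!: sum.cong)
      also have "\<dots> = g \<phi> + (2 * u * (\<Sum>b\<in>F. d b \<bullet> e b) + u\<^sup>2 * (\<Sum>b\<in>F. (cmod (e b))\<^sup>2))"
        unfolding g_def d_def[symmetric] sum_distrib_left sum.distrib[symmetric] power2_norm_eq_inner
        by (intro sum.cong refl)
          (simp add: inner_add_left inner_add_right inner_commute power2_eq_square algebra_simps)
      finally show "0 \<le> 2 * u * (\<Sum>b\<in>F. d b \<bullet> e b) + u\<^sup>2 * (\<Sum>b\<in>F. (cmod (e b))\<^sup>2)"
        by simp
    qed
    moreover have "g \<phi> = (\<Sum>b\<in>F. d b \<bullet> blinfun_apply \<phi> b) - (\<Sum>b\<in>F. d b \<bullet> blinfun_apply \<omega> b)"
      unfolding g_def sum_subtractf[symmetric] d_def[symmetric]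
      by (intro sum.cong refl) (simp add: power2_norm_eq_inner d_def inner_diff_right)
    moreover have "(\<Sum>b\<in>F. d b \<bullet> e b)
        = (\<Sum>b\<in>F. d b \<bullet> blinfun_apply \<psi> b) - (\<Sum>b\<in>F. d b \<bullet> blinfun_apply \<phi> b)"
      by (simp add: e_def inner_diff_right sum_subtractf)
    moreover have "\<psi> \<in> states" using \<psi> C by auto
    ultimately show ?thesis by (simp add: val \<omega>)
  qed
  then show ?thesis using that \<open>a \<in> A\<close> pos by blast
qed

section \<open>Unique extensions of pure states and pinnacle sets\<close>

lemma pinnacle_set_of_unique_extension:
  fixes A :: "'a::unital_cstar_algebra set"
  assumes A: "unital_subalgebra A" and pure: "pure_state \<omega>"
    and uniq: "state_extensions A \<omega> = {\<omega>}" and \<epsilon>: "\<epsilon> > 0"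
  shows "pinnacle_set A \<epsilon> \<omega>"
  unfolding pinnacle_set_def
proof (intro allI impI, elim conjE)
  fix K assume K: "compactin state_space K" "\<omega> \<notin> K"
  note A' = A[unfolded unital_subalgebra_def]
  have \<omega>: "\<omega> \<in> states" using pure by (simp add: pure_state_def extreme_point_of_def)
  obtain C where C: "convex C" "compactin strong_operator_topology C" "K \<subseteq> C" "C \<subseteq> states" "\<omega> \<notin> C"
    using pure_state_avoids_convex_neighbourhood[OF pure K] by blast
  obtain b \<delta> where b: "b \<in> A" "\<delta> > 0"
    and sep: "\<And>\<psi>. \<psi> \<in> C \<Longrightarrow> Re (blinfun_apply \<psi> b) + \<delta> \<le> Re (blinfun_apply \<omega> b)"
    using subspace_separates_convex_compact[of A C \<omega>] A' C \<omega> uniq by auto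
  \<comment> \<open>Shifting by a multiple of the unit puts the gap of width \<open>\<delta>\<close> symmetrically around 0.\<close>
  define \<eta> where "\<eta> = \<delta> / 2"
  have \<eta>: "\<eta> > 0" using b by (simp add: \<eta>_def)
  define a where "a = b + (complex_of_real (\<eta> - Re (blinfun_apply \<omega> b))) *\<^sub>C 1"
  have "a \<in> A" using b A' by (simp add: a_def)
  have shift: "Re (blinfun_apply \<psi> a) = Re (blinfun_apply \<psi> b) + \<eta> - Re (blinfun_apply \<omega> b)"
    if "\<psi> \<in> states" for \<psi>
    by (simp add: a_def blinfun.add_right state_scaleC[OF that] state_one[OF that])
  have \<omega>a: "Re (blinfun_apply \<omega> a) = \<eta>" by (simp add: shift \<omega>)
  have Ka: "Re (blinfun_apply \<psi> a) \<le> - \<eta>" if "\<psi> \<in> K" for \<psi>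
  proof -
    have "\<psi> \<in> C" "\<psi> \<in> states" using that C by auto
    then show ?thesis using sep[of \<psi>] shift[of \<psi>] by (simp add: \<eta>_def)
  qed
  \<comment> \<open>The first bound lets the linear term \<open>2 t \<eta>\<close> dominate the quadratic remainder, the second
    keeps the norm below \<open>1 + \<epsilon>\<close>.\<close>
  define t where "t = min (\<eta> / ((norm a)\<^sup>2 + 1)) (\<epsilon> / (norm a + 1))"
  have nn: "(norm a)\<^sup>2 + 1 > 0" "norm a + 1 > 0"
    by (simp_all add: add_nonneg_pos)
  have t: "t > 0" using \<eta> \<epsilon> nn by (simp add: t_def)
  have "t \<le> \<eta> / ((norm a)\<^sup>2 + 1)" "t \<le> \<epsilon> / (norm a + 1)"
    by (simp_all add: t_def)
  then have "t * ((norm a)\<^sup>2 + 1) \<le> \<eta>" "t * (norm a + 1) \<le> \<epsilon>"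
    using nn by (simp_all add: pos_le_divide_eq)
  then have t1: "t * (norm a)\<^sup>2 < \<eta>" and t2: "t * norm a \<le> \<epsilon>"
    using t by (simp_all add: distrib_left)
  have small: "\<bar>t\<^sup>2 * Re (blinfun_apply \<psi> (star a * a))\<bar> < t * \<eta>" if "\<psi> \<in> states" for \<psi>
  proof -
    have "\<bar>t\<^sup>2 * Re (blinfun_apply \<psi> (star a * a))\<bar> \<le> t\<^sup>2 * (norm a)\<^sup>2"
      using state_perturbed_square(2)[OF that] by (simp add: abs_mult mult_left_mono)
    also have "\<dots> < t * \<eta>"
      using t t1 by (simp add: power2_eq_square mult.assoc)
    finally show ?thesis .
  qed
  define x where "x = 1 + t *\<^sub>R a"
  have "x \<in> A" using \<open>a \<in> A\<close> A' by (simp add: x_def scaleR_scaleC)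
  moreover have "norm x \<le> 1 + \<epsilon>"
    using norm_triangle_ineq[of 1 "t *\<^sub>R a"] t t2 by (simp add: x_def)
  moreover have "blinfun_apply \<omega> (star x * x) > 1"
    using small[OF \<omega>] mult_pos_pos[OF t \<eta>]
    by (simp add: x_def state_perturbed_square(1)[OF \<omega>] \<omega>a less_complex_def)
  moreover have "1 > blinfun_apply \<psi> (star x * x)" if "\<psi> \<in> K" for \<psi>
  proof -
    have \<psi>: "\<psi> \<in> states" using that C by auto
    show ?thesis
      using small[OF \<psi>] mult_left_mono[OF Ka[OF that], of t] t mult_pos_pos[OF t \<eta>]
      by (simp add: x_def state_perturbed_square(1)[OF \<psi>] less_complex_def)
  qed
  ultimately show "\<exists>x\<in>A. norm x \<le> 1 + \<epsilon> \<and> (\<forall>\<Omega>\<in>state_extensions A \<omega>. \<forall>\<psi>\<in>K.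
      blinfun_apply \<Omega> (star x * x) > 1 \<and> 1 > blinfun_apply \<psi> (star x * x))"
    using uniq by auto
qed

theorem theorem2:
  fixes A :: "'a::unital_cstar_algebra set" and \<omega> :: "'a \<Rightarrow>\<^sub>L complex"
  assumes "unital_subalgebra A" and "closed A" and "pure_state \<omega>"
  defines "unique_extension \<equiv> state_extensions A \<omega> = {\<omega>}"
    and "all_pinnacle \<equiv> \<forall>\<epsilon>>0. pinnacle_set A \<epsilon> \<omega>"
    and "some_pinnacle \<equiv> \<exists>\<epsilon>>0. pinnacle_set A \<epsilon> \<omega>"
    and "separation \<equiv> \<forall>K. compactin state_space K \<and> \<omega> \<notin> K \<longrightarrow>
      (\<exists>x\<in>A. \<forall>\<psi>\<in>K. \<forall>\<Omega>\<in>state_extensions A \<omega>.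
        blinfun_apply \<Omega> (star x * x) > 1 \<and> 1 > blinfun_apply \<psi> (star x * x))"
  shows "(unique_extension \<longleftrightarrow> all_pinnacle) \<and>
    (unique_extension \<longleftrightarrow> some_pinnacle) \<and>
    (unique_extension \<longleftrightarrow> separation)"
proof -
  have "all_pinnacle" if "unique_extension"
    using pinnacle_set_of_unique_extension assms(1,3) that
    unfolding unique_extension_def all_pinnacle_def by blast
  moreover have "some_pinnacle" if "all_pinnacle"
    using that zero_less_one unfolding all_pinnacle_def some_pinnacle_def by blast
  moreover have "separation" if "some_pinnacle"
    using that unfolding some_pinnacle_def separation_def pinnacle_set_def by meson
  moreover have "unique_extension" if "separation"
  proof -
    have "\<omega> \<in> states"
      using assms(3) by (simp add: pure_state_def extreme_point_of_def)
    then have "\<omega> \<in> state_extensions A \<omega>"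
      by (simp add: state_extensions_def)
    moreover have "\<Omega> = \<omega>" if \<Omega>: "\<Omega> \<in> state_extensions A \<omega>" for \<Omega>
    proof (rule ccontr)
      assume "\<Omega> \<noteq> \<omega>"
      have "compactin state_space {\<Omega>}"
        using \<Omega> by (simp add: state_space_def state_extensions_def strong_operator_topology_topspace)
      then obtain x where "blinfun_apply \<Omega> (star x * x) > 1" "1 > blinfun_apply \<Omega> (star x * x)"
        using \<open>separation\<close> \<Omega> \<open>\<Omega> \<noteq> \<omega>\<close> unfolding separation_def by blast
      then show False by (metis less_asym)
    qed
    ultimately show ?thesis
      unfolding unique_extension_def by blast
  qed
  ultimately show ?thesis by blast
qed

end
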